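(* Let $\alpha,\beta,\gamma$ be complex numbers with $\beta\neq1$ such that $\Re\big(2-\beta+\frac{\alpha(\alpha-\gamma+1)}{\beta-1}\big)>0$, such that $\alpha+1$ and $\gamma+\frac{\alpha(\alpha-\gamma+1)}{\beta-1}$ are not non-positive integers, and such that $2\alpha+\alpha^2-\alpha\beta-\gamma-\alpha\gamma+\beta\gamma\neq0$. Then $$ {}_3F_2\!\left[\begin{matrix}\alpha,\ \beta,\ \gamma\\ \alpha+1,\ \gamma+\frac{\alpha(\alpha-\gamma+1)}{\beta-1}+1\end{matrix};1\right] =\frac{(\alpha-\beta+2)(\alpha+\alpha^2-\gamma-\alpha\gamma+\beta\gamma)}{(\alpha+1)(2\alpha+\alpha^2-\alpha\beta-\gamma-\alpha\gamma+\beta\gamma)}\; {}_3F_2\!\left[\begin{matrix}\alpha+1,\ \beta-1,\ \gamma\\ \alpha+2,\ \gamma+\frac{\alpha(\alpha-\gamma+1)}{\beta-1}\end{matrix};1\right]. $$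
   Context: For complex $a,b,c$ and complex $d,e$ that are not non-positive integers, ${}_3F_2\!\left[\begin{matrix}a,b,c\\ d,e\end{matrix};1\right]=\sum_{k=0}^{\infty}\frac{(a)_k(b)_k(c)_k}{k!\,(d)_k(e)_k}$, where $(x)_0=1$ and $(x)_k=x(x+1)\cdots(x+k-1)$ for $k\ge1$; the series converges when $\Re(d+e)>\Re(a+b+c)$. *)

theory Defs
  imports "HOL-Analysis.Analysis"
begin

text \<open>
  The value at unit argument of the hypergeometric series with upper parameters \<open>a, b, c\<close> and
  lower parameters \<open>d, e\<close>. It is only meaningful when \<open>d\<close> and \<open>e\<close> are not non-positive integers
  and the series converges, e.g. when \<open>Re (d + e) > Re (a + b + c)\<close>.
\<close>
definition hypergeo_3F2_at_1 :: "complex \<Rightarrow> complex \<Rightarrow> complex \<Rightarrow> complex \<Rightarrow> complex \<Rightarrow> complex" where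
  "hypergeo_3F2_at_1 a b c d e =
     (\<Sum>k. (pochhammer a k * pochhammer b k * pochhammer c k) /
           (fact k * pochhammer d k * pochhammer e k))"

end

theory Submission
  imports Defs "HOL-Library.Landau_Symbols"
begin

text \<open>
  Put \<open>b = \<beta> - 1\<close> and \<open>e = \<gamma> + \<alpha> (\<alpha> - \<gamma> + 1) / b\<close>, so that the two polynomials in the prefactor are
  \<open>b e\<close> and \<open>b (e - \<alpha>)\<close>. Write \<open>c\<^sub>k = (b)\<^sub>k (\<gamma>)\<^sub>k / (k! (e)\<^sub>k)\<close>. The two series have the terms
  \<open>\<alpha> e (b + k) / (b (\<alpha> + k) (e + k)) c\<^sub>k\<close> and \<open>(\<alpha> + 1) / (\<alpha> + 1 + k) c\<^sub>k\<close>, and the difference of the two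
  sides telescopes with \<open>G\<^sub>k = p k c\<^sub>k / (\<alpha> + k)\<close> for a constant \<open>p\<close>: matching the
  coefficients of \<open>k\<close> gives three linear conditions on \<open>p\<close> and the prefactor, which are consistent
  because of the choice of \<open>e\<close>. By the asymptotics of the Gamma function,
  \<open>c\<^sub>k = O(k\<^sup>-\<^sup>s)\<close> with \<open>s = Re (2 - \<beta> + \<alpha> (\<alpha> - \<gamma> + 1) / b) > 0\<close>, so that \<open>G\<^sub>k\<close> tends to \<open>0\<close>.
  As \<open>G\<^sub>0\<close> is \<open>0 / 0\<close> for \<open>\<alpha> = 0\<close>, the induction on the partial sums starts from \<open>G\<^sub>1\<close>.
\<close>

text \<open>Gauss's limit formula \<open>rGamma_series\<close> tends to \<open>rGamma\<close>, and
  \<open>rGamma b\<close> is nonzero, so the quotient of the two approximants stays bounded; what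
  remains is a power of \<open>n\<close>.\<close>

lemma pochhammer_quotient_bigo:
  fixes a b :: complex
  assumes "b \<notin> \<int>\<^sub>\<le>\<^sub>0"
  shows "(\<lambda>n. norm (pochhammer a n / pochhammer b n)) \<in> O(\<lambda>n. real n powr Re (a - b))"
proof -
  define f where "f n = rGamma_series a n / rGamma_series b n" for n
  have f: "(\<lambda>n. norm (f n)) \<in> O(\<lambda>_. 1)"
  proof (rule bigoI_tendsto)
    show "(\<lambda>n. norm (f n) / 1) \<longlonglongrightarrow> norm (rGamma a / rGamma b)"
      unfolding f_def div_by_1 using assms
      by (intro tendsto_norm tendsto_divide rGamma_series_LIMSEQ) (simp add: rGamma_eq_zero_iff)
  qed auto
  \<comment> \<open>\<open>rGamma_series z n\<close> contains \<open>pochhammer z (Suc n)\<close>,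
    hence the shifted index; the factorials cancel in \<open>f\<close>.\<close>
  have "pochhammer a (Suc n) / pochhammer b (Suc n) = f n * exp ((a - b) * of_real (ln (real n)))" for n
    by (simp add: f_def rGamma_series_def exp_diff left_diff_distrib)
  then have shift: "norm (pochhammer a (Suc n) / pochhammer b (Suc n)) =
      norm (f n) * norm (exp ((a - b) * of_real (ln (real n))))" for n
    by (simp only: norm_mult)
  have "(\<lambda>n. norm (exp ((a - b) * of_real (ln (real n))))) \<in> O(\<lambda>n. real n powr Re (a - b))"
    by (intro bigoI[of _ 1] eventually_mono[OF eventually_gt_at_top[of 0]]) (auto simp: powr_def)
  from landau_o.big.mult[OF f this]
  have "(\<lambda>n. norm (pochhammer a (Suc n) / pochhammer b (Suc n))) \<in> O(\<lambda>n. real n powr Re (a - b))"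
    by (simp only: shift mult_1)
  \<comment> \<open>The exponent may have either sign, so the change from \<open>n\<close> to
    \<open>Suc n\<close> uses that the ratio tends to 1 rather than monotonicity.\<close>
  also have "(\<lambda>n. real n powr Re (a - b)) \<in> O(\<lambda>n. real (Suc n) powr Re (a - b))"
  proof (rule bigoI_tendsto)
    have "(\<lambda>n. (real n / real (Suc n)) powr Re (a - b)) \<longlonglongrightarrow> 1 powr Re (a - b)"
      by (intro tendsto_powr LIMSEQ_n_over_Suc_n tendsto_const) auto
    then show "(\<lambda>n. real n powr Re (a - b) / real (Suc n) powr Re (a - b)) \<longlonglongrightarrow> 1"
      by (simp add: powr_divide)
  qed auto
  finally obtain C where
    "eventually (\<lambda>n. norm (norm (pochhammer a (Suc n) / pochhammer b (Suc n))) \<le>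
                      C * norm (real (Suc n) powr Re (a - b))) sequentially"
    by (elim landau_o.bigE)
  then show ?thesis
    by (intro bigoI[of _ C]) (subst (asm) eventually_sequentially_Suc)
qed

text \<open>With \<open>fact k\<close> read as \<open>pochhammer 1 k\<close>, each upper parameter
  is paired with a lower one. The exponents add up to a real number below -1.\<close>

lemma hypergeo_3F2_at_1_sums:
  fixes a b c d e :: complex
  assumes "d \<notin> \<int>\<^sub>\<le>\<^sub>0" "e \<notin> \<int>\<^sub>\<le>\<^sub>0" "Re (d + e) > Re (a + b + c)"
  shows "(\<lambda>k. (pochhammer a k * pochhammer b k * pochhammer c k) /
           (fact k * pochhammer d k * pochhammer e k)) sums hypergeo_3F2_at_1 a b c d e"
proof -
  have "(\<lambda>k. norm (pochhammer a k / pochhammer 1 k) * norm (pochhammer b k / pochhammer d k) *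
             norm (pochhammer c k / pochhammer e k))
     \<in> O(\<lambda>k. real k powr Re (a - 1) * real k powr Re (b - d) * real k powr Re (c - e))"
    using assms by (intro landau_o.big.mult pochhammer_quotient_bigo) auto
  then have bigo: "(\<lambda>k. norm (pochhammer a k * pochhammer b k * pochhammer c k /
           (fact k * pochhammer d k * pochhammer e k)))
      \<in> O(\<lambda>k. real k powr (Re (a + b + c) - Re (d + e) - 1))"
    by (simp add: norm_mult norm_divide powr_add[symmetric] algebra_simps flip: pochhammer_fact)
  have "summable (\<lambda>k. norm (real k powr (Re (a + b + c) - Re (d + e) - 1)))"
    using assms(3) by (simp add: summable_real_powr_iff)
  from summable_norm_cancel[OF summable_comparison_test_bigo[OF this bigo]] show ?thesis
    unfolding hypergeo_3F2_at_1_def by (rule summable_sums)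
qed

text \<open>The same pairing, needed for the boundary term of the telescoping sum. A negative
  exponent is enough here; the terms need not be summable.\<close>

lemma hypergeo_2F1_term_tendsto_0:
  fixes a b d :: complex
  assumes "d \<notin> \<int>\<^sub>\<le>\<^sub>0" "Re (d + 1) > Re (a + b)"
  shows "(\<lambda>k. pochhammer a k * pochhammer b k / (fact k * pochhammer d k)) \<longlonglongrightarrow> 0"
proof -
  have "(\<lambda>k. norm (pochhammer a k / pochhammer 1 k) * norm (pochhammer b k / pochhammer d k))
     \<in> O(\<lambda>k. real k powr Re (a - 1) * real k powr Re (b - d))"
    using assms by (intro landau_o.big.mult pochhammer_quotient_bigo) auto
  then have bigo: "(\<lambda>k. norm (pochhammer a k * pochhammer b k / (fact k * pochhammer d k)))
      \<in> O(\<lambda>k. real k powr (Re (a + b) - Re (d + 1)))"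
    by (simp add: norm_mult norm_divide powr_add[symmetric] algebra_simps flip: pochhammer_fact)
  have "(\<lambda>k. real k powr (Re (a + b) - Re (d + 1))) \<longlonglongrightarrow> 0"
    using assms(2) by (intro tendsto_neg_powr filterlim_real_sequentially) auto
  then have "(\<lambda>k. real k powr (Re (a + b) - Re (d + 1))) \<in> o(\<lambda>_. 1)"
    by (intro smalloI_tendsto) auto
  from smalloD_tendsto[OF landau_o.big_small_trans[OF bigo this]] show ?thesis
    by (simp add: tendsto_norm_zero_iff)
qed

text \<open>The left side minus the right side factors as \<open>(\<alpha> + x) * (b + x) *
  (\<gamma> * b + \<alpha> * (\<alpha> - \<gamma> + 1) - e * b)\<close>, and the assumption kills
  the last factor.\<close>

lemma telescoping_identity:
  fixes \<alpha> b \<gamma> e x :: complex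
  assumes "e * b = \<gamma> * b + \<alpha> * (\<alpha> - \<gamma> + 1)"
  shows "(b - \<alpha>) * ((b + x) * (\<gamma> + x) * (\<alpha> + x) - x * (e + x) * (\<alpha> + x + 1)) =
    \<alpha> * (e - \<alpha>) * (b + x) * (\<alpha> + x + 1) - b * (\<alpha> - b + 1) * (\<alpha> + x) * (e + x)"
  using assms by algebra

text \<open>This is the relation for the increment of \<open>G\<close> at \<open>x = k\<close>,
  divided by \<open>c\<^sub>k\<close>. The constant in front is the \<open>p\<close> of the
  overview.\<close>

lemma telescoping_step:
  fixes \<alpha> b \<gamma> e x :: complex
  assumes "e * b = \<gamma> * b + \<alpha> * (\<alpha> - \<gamma> + 1)" "b \<noteq> 0" "e \<noteq> \<alpha>"
    "\<alpha> + x \<noteq> 0" "\<alpha> + x + 1 \<noteq> 0" "e + x \<noteq> 0"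
  shows "e * (b - \<alpha>) / (b * (e - \<alpha>)) *
      ((b + x) * (\<gamma> + x) / ((e + x) * (\<alpha> + x + 1)) - x / (\<alpha> + x)) =
    \<alpha> * e * (b + x) / (b * (\<alpha> + x) * (e + x)) - (\<alpha> - b + 1) * e / (e - \<alpha>) / (\<alpha> + x + 1)"
proof -
  have "e - \<alpha> \<noteq> 0" using assms by auto
  have "e * (b - \<alpha>) / (b * (e - \<alpha>)) * ((b + x) * (\<gamma> + x) / ((e + x) * (\<alpha> + x + 1)) - x / (\<alpha> + x)) =
    e * ((b - \<alpha>) * ((b + x) * (\<gamma> + x) * (\<alpha> + x) - x * (e + x) * (\<alpha> + x + 1))) /
     (b * (e - \<alpha>) * (e + x) * (\<alpha> + x + 1) * (\<alpha> + x))"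
    using assms \<open>e - \<alpha> \<noteq> 0\<close> by (simp add: divide_simps)
  also have "\<dots> = e * (\<alpha> * (e - \<alpha>) * (b + x) * (\<alpha> + x + 1) - b * (\<alpha> - b + 1) * (\<alpha> + x) * (e + x)) /
     (b * (e - \<alpha>) * (e + x) * (\<alpha> + x + 1) * (\<alpha> + x))"
    by (subst telescoping_identity[OF assms(1)]) (rule refl)
  also have "\<dots> = \<alpha> * e * (b + x) / (b * (\<alpha> + x) * (e + x)) - (\<alpha> - b + 1) * e / (e - \<alpha>) / (\<alpha> + x + 1)"
    using assms \<open>e - \<alpha> \<noteq> 0\<close>
    by (simp add: divide_simps) (simp add: algebra_simps)
  finally show ?thesis .
qed

lemma pochhammer_divide_shift:
  fixes a :: complex
  assumes "a + 1 \<notin> \<int>\<^sub>\<le>\<^sub>0" "a + of_nat n \<noteq> 0"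
  shows "pochhammer a n / pochhammer (a + 1) n = a / (a + of_nat n)"
proof -
  have "pochhammer (a + 1) n \<noteq> 0"
    using assms(1) pochhammer_eq_0_imp_nonpos_Int by blast
  \<comment> \<open>Both sides are \<open>pochhammer a (Suc n)\<close>.\<close>
  moreover have "a * pochhammer (a + 1) n = (a + of_nat n) * pochhammer a n"
    by (metis pochhammer_rec pochhammer_rec')
  ultimately show ?thesis
    using assms(2) by (simp add: field_simps)
qed

text \<open>The right side is \<open>G\<close> at \<open>Suc n\<close>; its denominator never
  vanishes, even for \<alpha> = 0.\<close>

lemma hypergeo_partial_sum:
  fixes \<alpha> b \<gamma> e :: complex
  assumes rel: "e * b = \<gamma> * b + \<alpha> * (\<alpha> - \<gamma> + 1)"
    and b: "b \<noteq> 0" and e\<alpha>: "e \<noteq> \<alpha>" and \<alpha>: "\<alpha> + 1 \<notin> \<int>\<^sub>\<le>\<^sub>0" and e: "e \<notin> \<int>\<^sub>\<le>\<^sub>0"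
  shows "(\<Sum>k\<le>n. pochhammer \<alpha> k * pochhammer (b + 1) k * pochhammer \<gamma> k /
              (fact k * pochhammer (\<alpha> + 1) k * pochhammer (e + 1) k) -
            (\<alpha> - b + 1) * e / ((\<alpha> + 1) * (e - \<alpha>)) *
            (pochhammer (\<alpha> + 1) k * pochhammer b k * pochhammer \<gamma> k /
              (fact k * pochhammer (\<alpha> + 2) k * pochhammer e k))) =
         e * (b - \<alpha>) / (b * (e - \<alpha>)) * (of_nat (Suc n) / (\<alpha> + of_nat (Suc n))) *
         (pochhammer b (Suc n) * pochhammer \<gamma> (Suc n) / (fact (Suc n) * pochhammer e (Suc n)))"
    (is "(\<Sum>k\<le>n. ?t k - ?C * ?s k) = ?P * ?R n * ?c (Suc n)")
proof -
  have nz: "\<alpha> + 1 + of_nat n \<noteq> 0" "e + of_nat n \<noteq> 0" for n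
    using \<alpha> e plus_of_nat_eq_0_imp by blast+
  have \<alpha>1: "\<alpha> + 1 \<noteq> 0" and e0: "e \<noteq> 0"
    using nz[of 0] by auto
  have e\<alpha>0: "e - \<alpha> \<noteq> 0"
    using e\<alpha> by simp
  \<comment> \<open>The factor \<open>k\<close> in the numerator of \<open>G\<close> absorbs the new
    factor of the factorial.\<close>
  have c_Suc: "of_nat (Suc n) * ?c (Suc n) = (b + of_nat n) * (\<gamma> + of_nat n) / (e + of_nat n) * ?c n" for n
  proof -
    have "(of_nat (Suc n) :: complex) \<noteq> 0"
      by (simp del: of_nat_Suc)
    then show ?thesis
      by (simp add: pochhammer_Suc mult_ac del: of_nat_Suc)
  qed
  show ?thesis
  proof (induction n)
    case 0
    \<comment> \<open>The sum is now \<open>1 - C\<close>, to be matched with \<open>G\<close> at 1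
      directly, without dividing by \<alpha>.\<close>
    have "(\<alpha> + 1) * (e - \<alpha>) - (\<alpha> - b + 1) * e = (b - \<alpha>) * \<gamma>"
      using rel by algebra
    then have "1 - ?C = (b - \<alpha>) * \<gamma> / ((\<alpha> + 1) * (e - \<alpha>))"
      using \<alpha>1 e\<alpha>0 by (simp add: divide_simps)
    then show ?case
      using \<alpha>1 e0 b e\<alpha>0 by simp
  next
    case (Suc n)
    \<comment> \<open>Since \<open>x\<close> is at least 1, the assumption on
      \<open>\<alpha> + 1\<close> gives \<open>\<alpha> + x \<noteq> 0\<close>.\<close>
    define x :: complex where "x = of_nat (Suc n)"
    have x: "\<alpha> + x \<noteq> 0" "\<alpha> + 1 + x \<noteq> 0" "\<alpha> + x + 1 \<noteq> 0" "e + x \<noteq> 0"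
      using nz(1)[of n] nz(1)[of "Suc n"] nz(2)[of "Suc n"] by (auto simp: x_def add_ac)
    have e1: "e + 1 \<notin> \<int>\<^sub>\<le>\<^sub>0" and \<alpha>2: "\<alpha> + 1 + 1 \<notin> \<int>\<^sub>\<le>\<^sub>0"
      using e \<alpha> plus_one_in_nonpos_Ints_imp by blast+
    have \<beta>: "pochhammer (b + 1) k = pochhammer b k * (b + of_nat k) / b" for k
      using b by (metis nonzero_mult_div_cancel_left mult.commute pochhammer_rec pochhammer_rec')
    have t: "?t (Suc n) = \<alpha> * e * (b + x) / (b * (\<alpha> + x) * (e + x)) * ?c (Suc n)"
    proof -
      have "?t (Suc n) = pochhammer \<alpha> (Suc n) / pochhammer (\<alpha> + 1) (Suc n) *
          (pochhammer (b + 1) (Suc n) * pochhammer \<gamma> (Suc n) / fact (Suc n)) *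
          (pochhammer e (Suc n) / pochhammer (e + 1) (Suc n)) / pochhammer e (Suc n)"
        using e pochhammer_eq_0_imp_nonpos_Int[of e "Suc n"]
        by (simp only: times_divide_eq_left times_divide_eq_right mult_ac) auto
      also have "\<dots> = \<alpha> / (\<alpha> + x) * (pochhammer b (Suc n) * (b + x) / b * pochhammer \<gamma> (Suc n) / fact (Suc n)) *
          (e / (e + x)) / pochhammer e (Suc n)"
        by (simp only: pochhammer_divide_shift[OF \<alpha> x(1)[unfolded x_def]]
            pochhammer_divide_shift[OF e1 x(4)[unfolded x_def]] \<beta> x_def)
      also have "\<dots> = \<alpha> * e * (b + x) / (b * (\<alpha> + x) * (e + x)) * ?c (Suc n)"
        by (simp only: times_divide_eq_left times_divide_eq_right divide_divide_eq_left
            divide_divide_eq_right mult_ac)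
      finally show ?thesis .
    qed
    have s: "?C * ?s (Suc n) = (\<alpha> - b + 1) * e / (e - \<alpha>) / (\<alpha> + x + 1) * ?c (Suc n)"
    proof -
      have "?s (Suc n) = pochhammer (\<alpha> + 1) (Suc n) / pochhammer (\<alpha> + 1 + 1) (Suc n) * ?c (Suc n)"
        by (simp add: add.assoc mult_ac)
      also have "\<dots> = (\<alpha> + 1) / (\<alpha> + 1 + x) * ?c (Suc n)"
        by (simp only: pochhammer_divide_shift[OF \<alpha>2 x(2)[unfolded x_def]] x_def)
      finally show ?thesis
        using \<alpha>1 by (simp add: add_ac mult_ac)
    qed
    have "(\<Sum>k\<le>Suc n. ?t k - ?C * ?s k) = ?P * (x / (\<alpha> + x)) * ?c (Suc n) +
        (\<alpha> * e * (b + x) / (b * (\<alpha> + x) * (e + x)) -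
          (\<alpha> - b + 1) * e / (e - \<alpha>) / (\<alpha> + x + 1)) * ?c (Suc n)"
      by (simp only: sum.atMost_Suc Suc.IH t s left_diff_distrib x_def)
    \<comment> \<open>Read from right to left, \<open>telescoping_step\<close> turns the bracket
      into the increment of \<open>G\<close>, whose subtracted part cancels the induction
      hypothesis.\<close>
    also have "\<dots> = ?P * ((b + x) * (\<gamma> + x) / ((e + x) * (\<alpha> + x + 1))) * ?c (Suc n)"
      by (simp only: telescoping_step[OF rel b e\<alpha> x(1,3,4), symmetric]) (simp add: algebra_simps)
    also have "\<dots> = ?P / (\<alpha> + x + 1) * ((b + x) * (\<gamma> + x) / (e + x) * ?c (Suc n))"
      by (simp only: times_divide_eq_left times_divide_eq_right divide_divide_eq_left
          divide_divide_eq_right mult_ac)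
    also have "\<dots> = ?P / (\<alpha> + x + 1) * (of_nat (Suc (Suc n)) * ?c (Suc (Suc n)))"
      by (simp only: c_Suc[of "Suc n"] x_def)
    also have "\<dots> = ?P * ?R (Suc n) * ?c (Suc (Suc n))"
      by (simp only: times_divide_eq_left times_divide_eq_right divide_divide_eq_left mult_ac x_def
          of_nat_Suc add_ac)
    finally show ?case .
  qed
qed

theorem theorem2:
  fixes \<alpha> \<beta> \<gamma> :: complex
  assumes "\<beta> \<noteq> 1"
    and "Re (2 - \<beta> + \<alpha> * (\<alpha> - \<gamma> + 1) / (\<beta> - 1)) > 0"
    and "\<alpha> + 1 \<notin> \<int>\<^sub>\<le>\<^sub>0"
    and "\<gamma> + \<alpha> * (\<alpha> - \<gamma> + 1) / (\<beta> - 1) \<notin> \<int>\<^sub>\<le>\<^sub>0"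
    and "2 * \<alpha> + \<alpha>^2 - \<alpha> * \<beta> - \<gamma> - \<alpha> * \<gamma> + \<beta> * \<gamma> \<noteq> 0"
  shows "hypergeo_3F2_at_1 \<alpha> \<beta> \<gamma> (\<alpha> + 1) (\<gamma> + \<alpha> * (\<alpha> - \<gamma> + 1) / (\<beta> - 1) + 1) =
    ((\<alpha> - \<beta> + 2) * (\<alpha> + \<alpha>^2 - \<gamma> - \<alpha> * \<gamma> + \<beta> * \<gamma>)) /
    ((\<alpha> + 1) * (2 * \<alpha> + \<alpha>^2 - \<alpha> * \<beta> - \<gamma> - \<alpha> * \<gamma> + \<beta> * \<gamma>)) *
    hypergeo_3F2_at_1 (\<alpha> + 1) (\<beta> - 1) \<gamma> (\<alpha> + 2) (\<gamma> + \<alpha> * (\<alpha> - \<gamma> + 1) / (\<beta> - 1))"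
proof -
  define b where "b = \<beta> - 1"
  define e where "e = \<gamma> + \<alpha> * (\<alpha> - \<gamma> + 1) / b"
  have b: "b \<noteq> 0" and \<beta>: "\<beta> = b + 1"
    using assms(1) by (auto simp: b_def)
  have rel: "e * b = \<gamma> * b + \<alpha> * (\<alpha> - \<gamma> + 1)"
    using b by (simp add: e_def field_simps)
  have D: "2 * \<alpha> + \<alpha>^2 - \<alpha> * \<beta> - \<gamma> - \<alpha> * \<gamma> + \<beta> * \<gamma> = b * (e - \<alpha>)"
    and N: "\<alpha> + \<alpha>^2 - \<gamma> - \<alpha> * \<gamma> + \<beta> * \<gamma> = b * e"
    using rel unfolding \<beta> by algebra+
  have e\<alpha>: "e \<noteq> \<alpha>"
    using assms(5) unfolding D by auto
  have e: "e \<notin> \<int>\<^sub>\<le>\<^sub>0"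
    using assms(4) by (simp add: e_def b_def)
  then have e1: "e + 1 \<notin> \<int>\<^sub>\<le>\<^sub>0"
    using plus_one_in_nonpos_Ints_imp by blast
  have \<alpha>2: "\<alpha> + 2 \<notin> \<int>\<^sub>\<le>\<^sub>0"
    using assms(3) plus_one_in_nonpos_Ints_imp[of "\<alpha> + 1"] by (auto simp: add_ac)
  \<comment> \<open>Lower minus upper parameters sum to \<open>1 + e - b - \<gamma>\<close> in both
    series, so one inequality gives both convergences as well as the decay of
    \<open>c\<^sub>k\<close>.\<close>
  have "2 - \<beta> + \<alpha> * (\<alpha> - \<gamma> + 1) / (\<beta> - 1) = 1 + e - b - \<gamma>"
    by (simp add: e_def b_def)
  with assms(2) have Re: "Re (1 + e - b - \<gamma>) > 0"
    by simp
  \<comment> \<open>The prefactor of the claim with the common factor \<open>b\<close>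
    cancelled.\<close>
  define C where "C = (\<alpha> - b + 1) * e / ((\<alpha> + 1) * (e - \<alpha>))"
  let ?lhs = "hypergeo_3F2_at_1 \<alpha> (b + 1) \<gamma> (\<alpha> + 1) (e + 1)"
  let ?rhs = "hypergeo_3F2_at_1 (\<alpha> + 1) b \<gamma> (\<alpha> + 2) e"
  let ?S = "\<lambda>n. \<Sum>k\<le>n. pochhammer \<alpha> k * pochhammer (b + 1) k * pochhammer \<gamma> k /
              (fact k * pochhammer (\<alpha> + 1) k * pochhammer (e + 1) k) -
            C * (pochhammer (\<alpha> + 1) k * pochhammer b k * pochhammer \<gamma> k /
              (fact k * pochhammer (\<alpha> + 2) k * pochhammer e k))"
  have "?S \<longlonglongrightarrow> ?lhs - C * ?rhs"
    unfolding sums_def_le[symmetric]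
    by (intro sums_diff sums_mult hypergeo_3F2_at_1_sums) (use assms(3) \<alpha>2 e e1 Re in auto)
  moreover have "?S \<longlonglongrightarrow> 0"
  proof -
    have "(\<lambda>n. of_nat n / (\<alpha> + of_nat n)) \<longlonglongrightarrow> 1"
    proof (rule Lim_transform_eventually)
      have "(\<lambda>n. 1 / (\<alpha> / of_nat n + 1)) \<longlonglongrightarrow> 1 / (0 + 1)"
        by (intro tendsto_intros) auto
      then show "(\<lambda>n. 1 / (\<alpha> / of_nat n + 1)) \<longlonglongrightarrow> 1"
        by simp
      \<comment> \<open>The index 0 must be left out: division by zero yields 0, so the left side
        would be 1 and the right side 0.\<close>
      show "\<forall>\<^sub>F n in sequentially. 1 / (\<alpha> / of_nat n + 1) = of_nat n / (\<alpha> + of_nat n)"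
        using eventually_gt_at_top[of 0]
      proof eventually_elim
        case (elim n)
        then have "\<alpha> / of_nat n + 1 = (\<alpha> + of_nat n) / of_nat n"
          by (simp add: add_divide_distrib)
        then show ?case
          by simp
      qed
    qed
    moreover have "(\<lambda>n. pochhammer b n * pochhammer \<gamma> n / (fact n * pochhammer e n)) \<longlonglongrightarrow> 0"
      by (rule hypergeo_2F1_term_tendsto_0) (use e Re in auto)
    ultimately have "(\<lambda>n. e * (b - \<alpha>) / (b * (e - \<alpha>)) * (of_nat n / (\<alpha> + of_nat n)) *
        (pochhammer b n * pochhammer \<gamma> n / (fact n * pochhammer e n))) \<longlonglongrightarrow>
        e * (b - \<alpha>) / (b * (e - \<alpha>)) * 1 * 0"
      by (intro tendsto_mult tendsto_const)
    then show ?thesis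
      unfolding C_def hypergeo_partial_sum[OF rel b e\<alpha> assms(3) e]
      by (intro LIMSEQ_Suc) simp
  qed
  ultimately have "?lhs = C * ?rhs"
    using LIMSEQ_unique by fastforce
  moreover have "C = ((\<alpha> - \<beta> + 2) * (b * e)) / ((\<alpha> + 1) * (b * (e - \<alpha>)))"
  proof -
    have "\<alpha> - \<beta> + 2 = \<alpha> - b + 1"
      by (simp add: \<beta>)
    then show ?thesis
      using b by (simp add: C_def mult_ac)
  qed
  ultimately show ?thesis
    by (simp only: D N flip: e_def b_def) (simp add: \<beta>)
qed

end
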